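(* Let $K$ be a field and $F$ a set of functions $f:K^n\to K$ (possibly with different $n$ for different functions) containing a function which is not additively affine, and suppose that the topology that $G(F)_1$ induces on $K$ is Hausdorff. Let $I,I'$ be sets, let $E\subset K^I$ and $E'\subset K^{I'}$ be linear subspaces, both containing the constant functions and both stable under $F$, and let $\varphi:E\to E'$ be a unital $F$-homomorphism. Give $I$ the topology induced by $E$. Then there is a topology on the disjoint union $I\coprod I'$ such that $I$ (with its induced topology) is a dense subspace of $I\coprod I'$, every $\xi\in E$ has a (necessarily unique) extension to a function $\tilde\xi:I\coprod I'\to K$ that is continuous when $K$ is endowed with the topology induced by $G(F)_1$, and $\varphi(\xi)=\tilde\xi|_{I'}$ for every $\xi\in E$.
   Context: A function $f:K^n\to K$ ($n\ge1$) is additively affine if it is the sum of a constant and a homomorphism of additive groups. A linear subspace $E\subset K^I$ is stable under $f$ (equivalently, $f$ operates on $E$) if for all $\xi_1,\ldots,\xi_n\in E$ the function $f(\xi_1,\ldots,\xi_n):t\mapsto f(\xi_1(t),\ldots,\xi_n(t))$ is in $E$; $E$ is stable under $F$ if it is stable under each $f\in F$. A unital $F$-homomorphism $\varphi:E\to E'$ is a $K$-linear map such that $\varphi(f(\xi_1,\ldots,\xi_n))=f(\varphi(\xi_1),\ldots,\varphi(\xi_n))$ for every $f\in F$, $f:K^n\to K$, and all $\xi_1,\ldots,\xi_n\in E$, and which maps the constant function $\mathbf 1$ on $I$ to the constant function $\mathbf 1$ on $I'$. An operating semigroup is a sequence of linear subspaces $G_n\subset K^{K^n}$, $n=1,2,\ldots$,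 such that $G_n$ contains the constants and the $n$ coordinate functions $K^n\to K$, and for all $m,n$ every member of $G_m$ operates on $G_n$. $G(F)=(G(F)_n)_{n\ge1}$ is the operating semigroup generated by $F$, i.e. the smallest operating semigroup containing $F$ (each $f:K^n\to K$ in $F$ belonging to $G(F)_n$). For a linear subspace $E\subset K^X$ containing the constants, a subset $S\subset X$ is called $E$-closed if for every $t\in X\setminus S$ there is a $\xi\in E$ vanishing on $S$ with $\xi(t)\neq0$. If the union of any two $E$-closed sets is $E$-closed, the $E$-closed sets are the closed sets of a topology on $X$, called the topology induced by $E$. This is the case whenever $E$ is stable under some operation that is not additively affine; in particular it is so for the spaces $E$ on $I$ in the claim and for $G(F)_n$ on $K^n$. *)

theory Defs
  imports "HOL-Analysis.T1_Spaces"
begin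

text \<open>
  Elements of \<open>K^X\<close> are represented by functions of type \<open>'x \<Rightarrow> 'k\<close> that lie in
  \<^term>\<open>extensional X\<close>, so that equality in \<open>K^X\<close> is equality of functions. Elements of \<open>K^n\<close> are lists of
  length \<open>n\<close>; a function \<open>K^n \<rightarrow> K\<close> is then an element of \<open>K^X\<close> for \<open>X = tuples n\<close>.
\<close>

definition fun_const :: "'x set \<Rightarrow> 'k \<Rightarrow> 'x \<Rightarrow> 'k"
  where "fun_const X c = (\<lambda>t\<in>X. c)"

definition fun_add :: "'x set \<Rightarrow> ('x \<Rightarrow> 'k::field) \<Rightarrow> ('x \<Rightarrow> 'k) \<Rightarrow> 'x \<Rightarrow> 'k"
  where "fun_add X \<xi> \<eta> = (\<lambda>t\<in>X. \<xi> t + \<eta> t)"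

definition fun_scale :: "'x set \<Rightarrow> 'k::field \<Rightarrow> ('x \<Rightarrow> 'k) \<Rightarrow> 'x \<Rightarrow> 'k"
  where "fun_scale X c \<xi> = (\<lambda>t\<in>X. c * \<xi> t)"

definition fun_apply :: "'x set \<Rightarrow> ('k list \<Rightarrow> 'k) \<Rightarrow> ('x \<Rightarrow> 'k) list \<Rightarrow> 'x \<Rightarrow> 'k"
  where "fun_apply X f \<xi>s = (\<lambda>t\<in>X. f (map (\<lambda>\<xi>. \<xi> t) \<xi>s))"

definition linear_subspace :: "'x set \<Rightarrow> ('x \<Rightarrow> 'k::field) set \<Rightarrow> bool"
  where "linear_subspace X E \<longleftrightarrow>
    E \<subseteq> extensional X \<and> fun_const X 0 \<in> E \<and>
    (\<forall>\<xi>\<in>E. \<forall>\<eta>\<in>E. fun_add X \<xi> \<eta> \<in> E) \<and>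
    (\<forall>c. \<forall>\<xi>\<in>E. fun_scale X c \<xi> \<in> E)"

definition contains_constants :: "'x set \<Rightarrow> ('x \<Rightarrow> 'k) set \<Rightarrow> bool"
  where "contains_constants X E \<longleftrightarrow> (\<forall>c. fun_const X c \<in> E)"

definition tuples :: "nat \<Rightarrow> 'k list set"
  where "tuples n = {x. length x = n}"

definition additively_affine :: "nat \<Rightarrow> ('k::field list \<Rightarrow> 'k) \<Rightarrow> bool"
  where "additively_affine n f \<longleftrightarrow>
    (\<exists>c h. (\<forall>x\<in>tuples n. \<forall>y\<in>tuples n. h (map2 (+) x y) = h x + h y) \<and>
           (\<forall>x\<in>tuples n. f x = c + h x))"

definition operates_on :: "nat \<Rightarrow> ('k list \<Rightarrow> 'k) \<Rightarrow> 'x set \<Rightarrow> ('x \<Rightarrow> 'k) set \<Rightarrow> bool"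
  where "operates_on n f X E \<longleftrightarrow>
    (\<forall>\<xi>s. length \<xi>s = n \<and> set \<xi>s \<subseteq> E \<longrightarrow> fun_apply X f \<xi>s \<in> E)"

text \<open>
  A set of functions of possibly different arities is a set of pairs of an arity
  \<open>n \<ge> 1\<close> and a function \<open>K^n \<rightarrow> K\<close>.
\<close>

definition operations :: "(nat \<times> ('k list \<Rightarrow> 'k)) set"
  where "operations = (SIGMA n:{1..}. extensional (tuples n))"

definition stable_under ::
    "(nat \<times> ('k list \<Rightarrow> 'k)) set \<Rightarrow> 'x set \<Rightarrow> ('x \<Rightarrow> 'k) set \<Rightarrow> bool"
  where "stable_under F X E \<longleftrightarrow> (\<forall>(n, f)\<in>F. operates_on n f X E)"

definition linear_on ::
    "'x set \<Rightarrow> ('x \<Rightarrow> 'k::field) set \<Rightarrow> 'y set \<Rightarrow> (('x \<Rightarrow> 'k) \<Rightarrow> ('y \<Rightarrow> 'k)) \<Rightarrow> bool"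
  where "linear_on X E Y \<phi> \<longleftrightarrow>
    (\<forall>\<xi>\<in>E. \<forall>\<eta>\<in>E. \<phi> (fun_add X \<xi> \<eta>) = fun_add Y (\<phi> \<xi>) (\<phi> \<eta>)) \<and>
    (\<forall>c. \<forall>\<xi>\<in>E. \<phi> (fun_scale X c \<xi>) = fun_scale Y c (\<phi> \<xi>))"

definition unital_hom ::
    "(nat \<times> ('k::field list \<Rightarrow> 'k)) set \<Rightarrow> 'x set \<Rightarrow> ('x \<Rightarrow> 'k) set \<Rightarrow>
     'y set \<Rightarrow> ('y \<Rightarrow> 'k) set \<Rightarrow> (('x \<Rightarrow> 'k) \<Rightarrow> ('y \<Rightarrow> 'k)) \<Rightarrow> bool"
  where "unital_hom F X E Y E' \<phi> \<longleftrightarrow>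
    \<phi> \<in> E \<rightarrow> E' \<and> linear_on X E Y \<phi> \<and>
    (\<forall>(n, f)\<in>F. \<forall>\<xi>s. length \<xi>s = n \<and> set \<xi>s \<subseteq> E \<longrightarrow>
        \<phi> (fun_apply X f \<xi>s) = fun_apply Y f (map \<phi> \<xi>s)) \<and>
    \<phi> (fun_const X 1) = fun_const Y 1"

text \<open>The value of a sequence \<open>G\<close> at index \<open>0\<close> is irrelevant.\<close>

definition operating_semigroup :: "(nat \<Rightarrow> ('k::field list \<Rightarrow> 'k) set) \<Rightarrow> bool"
  where "operating_semigroup G \<longleftrightarrow>
    (\<forall>n\<ge>1. linear_subspace (tuples n) (G n) \<and> contains_constants (tuples n) (G n) \<and>
       (\<forall>i<n. (\<lambda>x\<in>tuples n. x ! i) \<in> G n)) \<and>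
    (\<forall>m\<ge>1. \<forall>n\<ge>1. \<forall>f\<in>G m. operates_on m f (tuples n) (G n))"

definition contains_operations ::
    "(nat \<times> ('k list \<Rightarrow> 'k)) set \<Rightarrow> (nat \<Rightarrow> ('k list \<Rightarrow> 'k) set) \<Rightarrow> bool"
  where "contains_operations F G \<longleftrightarrow> (\<forall>(n, f)\<in>F. f \<in> G n)"

definition generated_semigroup ::
    "(nat \<times> ('k::field list \<Rightarrow> 'k)) set \<Rightarrow> nat \<Rightarrow> ('k list \<Rightarrow> 'k) set"
  where "generated_semigroup F n =
    \<Inter> {G n |G. operating_semigroup G \<and> contains_operations F G}"

definition E_closed :: "'x set \<Rightarrow> ('x \<Rightarrow> 'k::field) set \<Rightarrow> 'x set \<Rightarrow> bool"
  where "E_closed X E S \<longleftrightarrow>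
    S \<subseteq> X \<and> (\<forall>t\<in>X - S. \<exists>\<xi>\<in>E. (\<forall>s\<in>S. \<xi> s = 0) \<and> \<xi> t \<noteq> 0)"

text \<open>
  Only meaningful if the union of two \<^term>\<open>E_closed X E\<close> sets is again one; see
  \<open>closedin_induced_topology\<close> and \<open>E_closed_Un\<close> below.
\<close>

definition induced_topology :: "'x set \<Rightarrow> ('x \<Rightarrow> 'k::field) set \<Rightarrow> 'x topology"
  where "induced_topology X E = topology (\<lambda>U. U \<subseteq> X \<and> E_closed X E (X - U))"

text \<open>\<open>K^1\<close> is identified with \<open>K\<close> via \<open>[x] \<mapsto> x\<close>.\<close>

definition unary_functions :: "(nat \<times> ('k::field list \<Rightarrow> 'k)) set \<Rightarrow> ('k \<Rightarrow> 'k) set"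
  where "unary_functions F = (\<lambda>g x. g [x]) ` generated_semigroup F 1"

definition field_topology :: "(nat \<times> ('k::field list \<Rightarrow> 'k)) set \<Rightarrow> 'k topology"
  where "field_topology F = induced_topology UNIV (unary_functions F)"

definition continuous_extension ::
    "('x + 'y) topology \<Rightarrow> 'k topology \<Rightarrow> 'x set \<Rightarrow> ('x \<Rightarrow> 'k) \<Rightarrow> ('x + 'y \<Rightarrow> 'k) \<Rightarrow> bool"
  where "continuous_extension T TK X \<xi> \<zeta> \<longleftrightarrow>
    \<zeta> \<in> extensional (topspace T) \<and> (\<forall>t\<in>X. \<zeta> (Inl t) = \<xi> t) \<and> continuous_map T TK \<zeta>"


subsection \<open>Sanity of the definitions\<close>

lemma generated_semigroup_least:
  assumes "operating_semigroup G" "contains_operations F G"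
  shows "generated_semigroup F n \<subseteq> G n"
  using assms unfolding generated_semigroup_def by blast

lemma contains_operations_generated_semigroup:
  "contains_operations F (generated_semigroup F)"
  unfolding contains_operations_def generated_semigroup_def by blast

lemma operating_semigroup_full: "operating_semigroup (\<lambda>n. extensional (tuples n))"
  unfolding operating_semigroup_def linear_subspace_def contains_constants_def
    operates_on_def fun_const_def fun_add_def fun_scale_def fun_apply_def
  by simp

lemma operating_semigroup_generated_semigroup:
  fixes F :: "(nat \<times> ('k::field list \<Rightarrow> 'k)) set"
  assumes F: "F \<subseteq> operations"
  shows "operating_semigroup (generated_semigroup F)"
proof -
  let ?P = "\<lambda>G. operating_semigroup G \<and> contains_operations F G"
  have mem: "f \<in> generated_semigroup F n \<longleftrightarrow> (\<forall>G. ?P G \<longrightarrow> f \<in> G n)" for f n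
    unfolding generated_semigroup_def by blast
  have "contains_operations F (\<lambda>n. extensional (tuples n))"
    using F unfolding operations_def contains_operations_def by auto
  then have ext: "generated_semigroup F n \<subseteq> extensional (tuples n)" for n
    using generated_semigroup_least[OF operating_semigroup_full] by blast
  have sub: "linear_subspace (tuples n) (generated_semigroup F n)" if "n \<ge> 1" for n
    unfolding linear_subspace_def
    using that ext by (auto simp: mem operating_semigroup_def linear_subspace_def)
  have const: "contains_constants (tuples n) (generated_semigroup F n)" if "n \<ge> 1" for n
    using that by (auto simp: mem operating_semigroup_def contains_constants_def)
  have coord: "(\<lambda>x\<in>tuples n. x ! i) \<in> generated_semigroup F n" if "n \<ge> 1" "i < n" for n i
    using that by (auto simp: mem operating_semigroup_def)
  have op: "operates_on m f (tuples n) (generated_semigroup F n)"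
    if "m \<ge> 1" "n \<ge> 1" "f \<in> generated_semigroup F m" for m n f
    unfolding operates_on_def
  proof (intro allI impI)
    fix \<xi>s :: "('k list \<Rightarrow> 'k) list"
    assume \<xi>s: "length \<xi>s = m \<and> set \<xi>s \<subseteq> generated_semigroup F n"
    have "fun_apply (tuples n) f \<xi>s \<in> G n" if G: "?P G" for G
    proof -
      have "f \<in> G m" "set \<xi>s \<subseteq> G n"
        using G \<xi>s \<open>f \<in> generated_semigroup F m\<close> generated_semigroup_least by (blast, blast)
      then show ?thesis
        using G \<xi>s \<open>m \<ge> 1\<close> \<open>n \<ge> 1\<close> unfolding operating_semigroup_def operates_on_def by blast
    qed
    then show "fun_apply (tuples n) f \<xi>s \<in> generated_semigroup F n"
      by (simp add: mem)
  qed
  show ?thesis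
    unfolding operating_semigroup_def using sub const coord op by blast
qed

lemma istopology_induced:
  assumes Un: "\<And>S T. E_closed X E S \<Longrightarrow> E_closed X E T \<Longrightarrow> E_closed X E (S \<union> T)"
  shows "istopology (\<lambda>U. U \<subseteq> X \<and> E_closed X E (X - U))"
  unfolding istopology_def
proof (intro conjI allI impI)
  fix S T assume S: "S \<subseteq> X \<and> E_closed X E (X - S)" and T: "T \<subseteq> X \<and> E_closed X E (X - T)"
  show "S \<inter> T \<subseteq> X" using S by blast
  show "E_closed X E (X - S \<inter> T)"
    unfolding Diff_Int using S T by (intro Un) simp_all
next
  fix \<K> assume K: "\<forall>U\<in>\<K>. U \<subseteq> X \<and> E_closed X E (X - U)"
  then show "\<Union>\<K> \<subseteq> X" by blast
  show "E_closed X E (X - \<Union>\<K>)"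
    unfolding E_closed_def
  proof (intro conjI ballI)
    fix t assume "t \<in> X - (X - \<Union>\<K>)"
    then obtain U where U: "U \<in> \<K>" "t \<in> U" "t \<in> X - (X - U)" by blast
    have "E_closed X E (X - U)" using K U by simp
    then obtain \<xi> where "\<xi> \<in> E" "\<forall>s\<in>X - U. \<xi> s = 0" "\<xi> t \<noteq> 0"
      using U(3) unfolding E_closed_def by blast
    moreover have "X - \<Union>\<K> \<subseteq> X - U" using U by blast
    ultimately show "\<exists>\<xi>\<in>E. (\<forall>s\<in>X - \<Union>\<K>. \<xi> s = 0) \<and> \<xi> t \<noteq> 0" by blast
  qed blast
qed

lemma closedin_induced_topology:
  assumes "\<And>S T. E_closed X E S \<Longrightarrow> E_closed X E T \<Longrightarrow> E_closed X E (S \<union> T)"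
    and "contains_constants X E"
  shows "topspace (induced_topology X E) = X"
    and "closedin (induced_topology X E) S \<longleftrightarrow> E_closed X E S"
proof -
  have op: "openin (induced_topology X E) U \<longleftrightarrow> U \<subseteq> X \<and> E_closed X E (X - U)" for U
    unfolding induced_topology_def
    using topology_inverse'[OF istopology_induced[of X E]] assms(1) by simp
  have "fun_const X 1 \<in> E" using assms(2) by (simp add: contains_constants_def)
  then have "E_closed X E {}" unfolding E_closed_def fun_const_def by force
  then show top: "topspace (induced_topology X E) = X"
    unfolding topspace_def op by auto
  show "closedin (induced_topology X E) S \<longleftrightarrow> E_closed X E S"
    unfolding closedin_def top op by (auto simp: double_diff E_closed_def)
qed

lemma not_additively_affineD:
  assumes "\<not> additively_affine n f"
  obtains a b where "a \<in> tuples n" "b \<in> tuples n"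
    "f (map2 (+) a b) - f a - f b + f (replicate n 0) \<noteq> 0"
proof -
  let ?h = "\<lambda>x. f x - f (replicate n 0)"
  have "\<exists>a\<in>tuples n. \<exists>b\<in>tuples n. ?h (map2 (+) a b) \<noteq> ?h a + ?h b"
  proof (rule ccontr)
    assume "\<not> ?thesis"
    then have "\<forall>x\<in>tuples n. \<forall>y\<in>tuples n. ?h (map2 (+) x y) = ?h x + ?h y" by blast
    moreover have "\<forall>x\<in>tuples n. f x = f (replicate n 0) + ?h x" by simp
    ultimately have "additively_affine n f"
      unfolding additively_affine_def
      by (intro exI[of _ "f (replicate n 0)"] exI[of _ ?h]) (rule conjI)
    with assms show False by blast
  qed
  then show thesis using that by (auto simp: algebra_simps)
qed

lemma E_closed_Un:
  fixes E :: "('x \<Rightarrow> 'k::field) set"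
  assumes E: "linear_subspace X E" and const: "contains_constants X E"
    and op: "operates_on n f X E" and f: "\<not> additively_affine n f"
    and S: "E_closed X E S" and T: "E_closed X E T"
  shows "E_closed X E (S \<union> T)"
  unfolding E_closed_def
proof (intro conjI ballI)
  show ST: "S \<union> T \<subseteq> X" using S T by (auto simp: E_closed_def)
  fix t assume t: "t \<in> X - (S \<union> T)"
  have add: "fun_add X u v \<in> E" if "u \<in> E" "v \<in> E" for u v
    using E that by (simp add: linear_subspace_def)
  have scale: "fun_scale X c u \<in> E" if "u \<in> E" for c u
    using E that by (simp add: linear_subspace_def)
  obtain \<xi> where \<xi>: "\<xi> \<in> E" "\<forall>s\<in>S. \<xi> s = 0" "\<xi> t \<noteq> 0"
    using S t unfolding E_closed_def by blast
  obtain \<eta> where \<eta>: "\<eta> \<in> E" "\<forall>s\<in>T. \<eta> s = 0" "\<eta> t \<noteq> 0"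
    using T t unfolding E_closed_def by blast
  obtain a b where ab: "length a = n" "length b = n"
    and ne: "f (map2 (+) a b) - f a - f b + f (replicate n 0) \<noteq> 0"
    using not_additively_affineD[OF f] unfolding tuples_def by blast
  define x where "x = fun_scale X (inverse (\<xi> t)) \<xi>"
  define y where "y = fun_scale X (inverse (\<eta> t)) \<eta>"
  have xy: "x \<in> E" "y \<in> E" using \<xi> \<eta> scale by (auto simp: x_def y_def)
  have xv: "x t = 1" "y t = 1" "\<And>s. s \<in> S \<Longrightarrow> x s = 0" "\<And>s. s \<in> T \<Longrightarrow> y s = 0"
    using \<xi> \<eta> t ST by (auto simp: x_def y_def fun_scale_def)
  define w where "w c d = fun_apply X f
    (map2 (\<lambda>p q. fun_add X (fun_scale X p (fun_scale X c x)) (fun_scale X q (fun_scale X d y))) a b)"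
    for c d
  have wE: "w c d \<in> E" for c d
    using ab xy add scale unfolding w_def
    by (intro op[unfolded operates_on_def, rule_format]) auto
  have wv: "w c d s = f (map2 (\<lambda>p q. p * (c * x s) + q * (d * y s)) a b)" if "s \<in> X" for c d s
    using that unfolding w_def
    by (auto simp: fun_apply_def fun_add_def fun_scale_def o_def split_def)
  define z where "z = fun_add X (fun_add X (w 1 1) (fun_scale X (-1) (w 1 0)))
    (fun_add X (fun_scale X (-1) (w 0 1)) (w 0 0))"
  have "z \<in> E" unfolding z_def by (intro add scale wE)
  have zv: "z s = w 1 1 s - w 1 0 s - w 0 1 s + w 0 0 s" if "s \<in> X" for s
    using that by (simp add: z_def fun_add_def fun_scale_def)
  have "z s = 0" if "s \<in> S \<union> T" for s
  proof -
    have "s \<in> X" using ST that by blast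
    then show ?thesis using that xv by (auto simp: zv wv)
  qed
  moreover have "z t \<noteq> 0"
  proof -
    have eqs: "map2 (\<lambda>p q. p) a b = a" "map2 (\<lambda>p q. q) a b = b"
      "map2 (\<lambda>p q. 0 :: 'k) a b = replicate n 0"
      using ab by (auto intro!: nth_equalityI)
    then show ?thesis using t xv ne by (simp add: zv wv)
  qed
  ultimately show "\<exists>\<xi>\<in>E. (\<forall>s\<in>S \<union> T. \<xi> s = 0) \<and> \<xi> t \<noteq> 0" using \<open>z \<in> E\<close> by blast
qed

lemma unary_functions_subspace:
  fixes F :: "(nat \<times> ('k::field list \<Rightarrow> 'k)) set"
  assumes F: "F \<subseteq> operations"
  shows "linear_subspace UNIV (unary_functions F)"
    and "contains_constants UNIV (unary_functions F)"
    and "stable_under F UNIV (unary_functions F)"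
proof -
  let ?G = "generated_semigroup F 1"
  note os = operating_semigroup_generated_semigroup[OF F]
  have sub: "linear_subspace (tuples 1) ?G" and con: "contains_constants (tuples 1) ?G"
    using os by (auto simp: operating_semigroup_def)
  have one: "[x] \<in> tuples 1" for x :: 'k by (simp add: tuples_def)
  have memI: "h \<in> unary_functions F" if "g \<in> ?G" "\<And>x. h x = g [x]" for g h
    using that unfolding unary_functions_def by (auto simp: image_iff intro!: bexI[of _ g])
  show con': "contains_constants UNIV (unary_functions F)"
    unfolding contains_constants_def
  proof
    fix c
    have "fun_const (tuples 1) c \<in> ?G" using con by (simp add: contains_constants_def)
    then show "fun_const UNIV c \<in> unary_functions F"
      by (rule memI) (use one in \<open>simp add: fun_const_def\<close>)
  qed
  show "linear_subspace UNIV (unary_functions F)"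
    unfolding linear_subspace_def
  proof (intro conjI ballI allI)
    fix u v assume "u \<in> unary_functions F" "v \<in> unary_functions F"
    then obtain g h where gh: "g \<in> ?G" "h \<in> ?G" "\<And>x. u x = g [x]" "\<And>x. v x = h [x]"
      unfolding unary_functions_def by auto
    then have "fun_add (tuples 1) g h \<in> ?G" using sub by (simp add: linear_subspace_def)
    then show "fun_add UNIV u v \<in> unary_functions F"
      by (rule memI) (use one gh in \<open>simp add: fun_add_def\<close>)
  next
    fix c u assume "u \<in> unary_functions F"
    then obtain g where g: "g \<in> ?G" "\<And>x. u x = g [x]"
      unfolding unary_functions_def by auto
    then have "fun_scale (tuples 1) c g \<in> ?G" using sub by (simp add: linear_subspace_def)
    then show "fun_scale UNIV c u \<in> unary_functions F"
      by (rule memI) (use one g in \<open>simp add: fun_scale_def\<close>)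
  qed (use con' in \<open>auto simp: contains_constants_def\<close>)
  show "stable_under F UNIV (unary_functions F)"
    unfolding stable_under_def operates_on_def
  proof (intro ballI case_prodI2 allI impI)
    fix p n f and us :: "('k \<Rightarrow> 'k) list"
    assume "p \<in> F" "p = (n, f)" and "length us = n \<and> set us \<subseteq> unary_functions F"
    then have nf: "(n, f) \<in> F" and us: "set us \<subseteq> unary_functions F" and n: "n = length us"
      by auto
    have "\<forall>u\<in>set us. \<exists>g. g \<in> ?G \<and> u = (\<lambda>x. g [x])"
      using us unfolding unary_functions_def by blast
    then obtain c where c: "\<And>u. u \<in> set us \<Longrightarrow> c u \<in> ?G \<and> u = (\<lambda>x. c u [x])" by metis
    have "n \<ge> 1" using nf F by (auto simp: operations_def)
    moreover have "f \<in> generated_semigroup F n"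
      using nf contains_operations_generated_semigroup[of F]
      by (auto simp: contains_operations_def)
    ultimately have "operates_on n f (tuples 1) ?G"
      using os unfolding operating_semigroup_def by blast
    moreover have "set (map c us) \<subseteq> ?G" using c by auto
    ultimately have "fun_apply (tuples 1) f (map c us) \<in> ?G"
      using n unfolding operates_on_def by simp
    then show "fun_apply UNIV f us \<in> unary_functions F"
    proof (rule memI)
      fix x
      have "map (\<lambda>u. u x) us = map (\<lambda>u. c u [x]) us"
        using c by (intro map_cong refl) metis
      then show "fun_apply UNIV f us x = fun_apply (tuples 1) f (map c us) [x]"
        using one by (simp add: fun_apply_def o_def del: map_eq_conv)
    qed
  qed
qed

end

theory Submission
  imports Defs "HOL-Analysis.Abstract_Topological_Spaces"
begin

text \<open>
  Extend each \<open>\<xi> \<in> E\<close> to \<open>I \<Coprod> I'\<close> by \<open>\<phi> \<xi>\<close> on \<open>I'\<close>. The extensions form a linear subspace of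
  \<open>K^(I \<Coprod> I')\<close> that contains the constants and is stable under \<open>F\<close>, precisely because \<open>\<phi>\<close> is a
  unital \<open>F\<close>-homomorphism; give \<open>I \<Coprod> I'\<close> the topology that it induces. An extension vanishing on \<open>I\<close>
  is zero, so \<open>I\<close> is dense. A space stable under \<open>F\<close> is stable under \<open>G(F)\<close>, so if \<open>g \<in> G(F)\<^sub>1\<close> and
  \<open>\<zeta>\<close> is an extension, then so is \<open>g \<circ> \<zeta>\<close>; hence preimages of closed sets under \<open>\<zeta>\<close> are closed.
\<close>

section \<open>Stability of \<open>E\<close> under the generated operating semigroup\<close>

lemma linear_subspace_add:
  "linear_subspace X E \<Longrightarrow> \<xi> \<in> E \<Longrightarrow> \<eta> \<in> E \<Longrightarrow> fun_add X \<xi> \<eta> \<in> E"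
  by (simp add: linear_subspace_def)

lemma linear_subspace_scale:
  "linear_subspace X E \<Longrightarrow> \<xi> \<in> E \<Longrightarrow> fun_scale X c \<xi> \<in> E"
  by (simp add: linear_subspace_def)

lemma operates_onD:
  "operates_on n f X E \<Longrightarrow> length \<xi>s = n \<Longrightarrow> set \<xi>s \<subseteq> E \<Longrightarrow> fun_apply X f \<xi>s \<in> E"
  by (simp add: operates_on_def)

text \<open>Sums, multiples and compositions of operations act on tuples from \<open>E\<close> by
  sums, multiples and compositions in \<open>E\<close>. The lemma puts the minimality of
  \<open>generated_semigroup F\<close> to use: this semigroup is the one to compare it with.\<close>

lemma operating_semigroup_operates_on:
  fixes E :: "('x \<Rightarrow> 'k::field) set"
  assumes E: "linear_subspace X E" and const: "contains_constants X E"
  shows "operating_semigroup (\<lambda>n. {g \<in> extensional (tuples n). operates_on n g X E})"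
    (is "operating_semigroup ?G")
  unfolding operating_semigroup_def
proof (intro conjI allI impI ballI)
  fix n :: nat
  have in_tuples: "map (\<lambda>\<xi>. \<xi> t) \<xi>s \<in> tuples n" if "length \<xi>s = n" for \<xi>s :: "('x \<Rightarrow> 'k) list" and t
    using that by (simp add: tuples_def)
  have const_mem: "fun_const (tuples n) c \<in> ?G n" for c
  proof -
    have "fun_apply X (fun_const (tuples n) c) \<xi>s = fun_const X c" if "length \<xi>s = n" for \<xi>s
      using in_tuples[OF that] by (simp add: fun_apply_def fun_const_def)
    then show ?thesis
      using const by (simp add: operates_on_def contains_constants_def) (simp add: fun_const_def)
  qed
  then show "contains_constants (tuples n) (?G n)"
    unfolding contains_constants_def by blast
  have add: "fun_add (tuples n) g h \<in> ?G n" if "g \<in> ?G n" "h \<in> ?G n" for g h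
  proof -
    have "fun_apply X (fun_add (tuples n) g h) \<xi>s = fun_add X (fun_apply X g \<xi>s) (fun_apply X h \<xi>s)"
      if "length \<xi>s = n" for \<xi>s
      using in_tuples[OF that] by (auto simp: fun_apply_def fun_add_def)
    then show ?thesis
      using that linear_subspace_add[OF E]
      by (simp add: operates_on_def) (simp add: fun_add_def)
  qed
  have scale: "fun_scale (tuples n) c g \<in> ?G n" if "g \<in> ?G n" for c g
  proof -
    have "fun_apply X (fun_scale (tuples n) c g) \<xi>s = fun_scale X c (fun_apply X g \<xi>s)"
      if "length \<xi>s = n" for \<xi>s
      using in_tuples[OF that] by (auto simp: fun_apply_def fun_scale_def)
    then show ?thesis
      using that linear_subspace_scale[OF E]
      by (simp add: operates_on_def) (simp add: fun_scale_def)
  qed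
  show "linear_subspace (tuples n) (?G n)"
    unfolding linear_subspace_def using const_mem add scale by blast
next
  fix n i :: nat assume "i < n"
  have "fun_apply X (\<lambda>x\<in>tuples n. x ! i) \<xi>s = \<xi>s ! i" if "length \<xi>s = n" "set \<xi>s \<subseteq> E" for \<xi>s
  proof -
    \<comment> \<open>\<open>fun_apply\<close> returns a function restricted to \<open>X\<close>; it
      coincides with \<open>\<xi>s ! i\<close> only because members of \<open>E\<close> take the
      default value off \<open>X\<close>.\<close>
    have "\<xi>s ! i \<in> extensional X"
      using that \<open>i < n\<close> E unfolding linear_subspace_def by (meson nth_mem subsetD)
    then show ?thesis
      using that \<open>i < n\<close>
      by (auto simp: fun_apply_def tuples_def extensional_def restrict_def fun_eq_iff)
  qed
  then show "(\<lambda>x\<in>tuples n. x ! i) \<in> ?G n"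
    using \<open>i < n\<close> by (auto simp: operates_on_def)
next
  fix m n :: nat and f assume f: "f \<in> ?G m"
  have "operates_on n (fun_apply (tuples n) f gs) X E" if gs: "length gs = m" "set gs \<subseteq> ?G n" for gs
    unfolding operates_on_def
  proof (intro allI impI)
    fix \<xi>s assume \<xi>s: "length \<xi>s = n \<and> set \<xi>s \<subseteq> E"
    \<comment> \<open>Associativity of composition: each \<open>g\<close> in \<open>gs\<close> first
      sends \<open>\<xi>s\<close> to a member of \<open>E\<close>, then \<open>f\<close> combines
      the results within \<open>E\<close>.\<close>
    have "fun_apply X (fun_apply (tuples n) f gs) \<xi>s = fun_apply X f (map (\<lambda>g. fun_apply X g \<xi>s) gs)"
      using \<xi>s by (auto simp: fun_apply_def tuples_def o_def)
    also have "\<dots> \<in> E"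
    proof (rule operates_onD)
      show "operates_on m f X E" using f by simp
      show "set (map (\<lambda>g. fun_apply X g \<xi>s) gs) \<subseteq> E"
        using gs \<xi>s by (auto simp: operates_on_def)
    qed (simp add: gs)
    finally show "fun_apply X (fun_apply (tuples n) f gs) \<xi>s \<in> E" .
  qed
  then show "operates_on m f (tuples n) (?G n)"
    unfolding operates_on_def[of m] by (simp add: fun_apply_def)
qed

lemma generated_semigroup_operates_on:
  assumes "F \<subseteq> operations"
    and "linear_subspace X E" "contains_constants X E" "stable_under F X E"
    and "g \<in> generated_semigroup F n"
  shows "operates_on n g X E"
proof -
  \<comment> \<open>Stability puts \<open>F\<close> inside the semigroup of all functions operating
    on \<open>E\<close>, so minimality puts all of \<open>generated_semigroup F\<close>
    there.\<close>
  have "contains_operations F (\<lambda>n. {g \<in> extensional (tuples n). operates_on n g X E})"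
    using assms(1,4) unfolding contains_operations_def stable_under_def operations_def by auto
  then show ?thesis
    using generated_semigroup_least[OF operating_semigroup_operates_on[OF assms(2,3)]] assms(5)
    by blast
qed

lemma unary_functions_comp:
  assumes "F \<subseteq> operations"
    and "linear_subspace X E" "contains_constants X E" "stable_under F X E"
    and "u \<in> unary_functions F" "\<xi> \<in> E"
  shows "(\<lambda>t\<in>X. u (\<xi> t)) \<in> E"
proof -
  obtain g where g: "g \<in> generated_semigroup F 1" "u = (\<lambda>x. g [x])"
    using assms(5) unfolding unary_functions_def by blast
  \<comment> \<open>Under the identification of \<open>K^1\<close> with \<open>K\<close>, applying
    \<open>g\<close> to a one-element list is composing \<open>u\<close> with
    \<open>\<xi>\<close>.\<close>
  have "fun_apply X g [\<xi>] \<in> E"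
    using generated_semigroup_operates_on[OF assms(1-4) g(1)] assms(6)
    by (intro operates_onD) auto
  then show ?thesis by (simp add: g(2) fun_apply_def)
qed

section \<open>Closed sets, continuity and embeddings for induced topologies\<close>

text \<open>Some member of \<open>F\<close> that is not additively affine operates on
  \<open>E\<close>, which makes unions of two \<open>E\<close>-closed sets
  \<open>E\<close>-closed.\<close>

lemma closedin_induced_topology_stable:
  assumes "\<exists>(n, f)\<in>F. \<not> additively_affine n f"
    and "linear_subspace X E" "contains_constants X E" "stable_under F X E"
  shows "topspace (induced_topology X E) = X"
    and "closedin (induced_topology X E) S \<longleftrightarrow> E_closed X E S"
proof -
  obtain n f where "operates_on n f X E" "\<not> additively_affine n f"
    using assms(1,4) unfolding stable_under_def by blast
  note Un = E_closed_Un[OF assms(2,3) this]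
  show "topspace (induced_topology X E) = X"
    and "closedin (induced_topology X E) S \<longleftrightarrow> E_closed X E S"
    using closedin_induced_topology[OF Un assms(3)] by blast+
qed

text \<open>A unary function \<open>u\<close> separating \<open>\<xi> t\<close> from a closed set
  \<open>C\<close> pulls back along \<open>\<xi>\<close> to a member of \<open>E\<close> separating
  \<open>t\<close> from the preimage of \<open>C\<close>.\<close>

lemma continuous_map_induced_topology:
  assumes F: "F \<subseteq> operations" "\<exists>(n, f)\<in>F. \<not> additively_affine n f"
    and E: "linear_subspace X E" "contains_constants X E" "stable_under F X E"
    and \<xi>: "\<xi> \<in> E"
  shows "continuous_map (induced_topology X E) (field_topology F) \<xi>"
proof -
  \<comment> \<open>The field is itself an instance: \<open>unary_functions F\<close> is a stable
    space on \<open>UNIV\<close>.\<close>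
  note K = closedin_induced_topology_stable[OF F(2) unary_functions_subspace[OF F(1)],
      folded field_topology_def]
  note X = closedin_induced_topology_stable[OF F(2) E]
  have "E_closed X E {t \<in> X. \<xi> t \<in> C}" if C: "E_closed UNIV (unary_functions F) C" for C
    unfolding E_closed_def
  proof (intro conjI ballI)
    fix t assume "t \<in> X - {t \<in> X. \<xi> t \<in> C}"
    then have t: "t \<in> X" "\<xi> t \<in> UNIV - C" by auto
    then obtain u where u: "u \<in> unary_functions F" "\<forall>s\<in>C. u s = 0" "u (\<xi> t) \<noteq> 0"
      using C unfolding E_closed_def by blast
    have "(\<lambda>t\<in>X. u (\<xi> t)) \<in> E"
      by (rule unary_functions_comp[OF F(1) E u(1) \<xi>])
    then show "\<exists>\<eta>\<in>E. (\<forall>s\<in>{t \<in> X. \<xi> t \<in> C}. \<eta> s = 0) \<and> \<eta> t \<noteq> 0"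
      using t u by (intro bexI) auto
  qed auto
  then show ?thesis
    unfolding continuous_map_closedin K X by simp
qed

text \<open>The two inclusions in \<open>restr\<close> do separate work: restrictions of members of
  \<open>D\<close> lie in \<open>E\<close>, which gives continuity, and every member of
  \<open>E\<close> lifts to \<open>D\<close>, which gives closedness onto the image.\<close>

lemma embedding_map_induced_topology:
  assumes nonaffine: "\<exists>(n, f)\<in>F. \<not> additively_affine n f"
    and E: "linear_subspace X E" "contains_constants X E" "stable_under F X E"
    and D: "linear_subspace Y D" "contains_constants Y D" "stable_under F Y D"
    and j: "inj_on j X" "j ` X \<subseteq> Y"
    and restr: "E = (\<lambda>\<zeta>. \<lambda>t\<in>X. \<zeta> (j t)) ` D"
  shows "embedding_map (induced_topology X E) (induced_topology Y D) j"
proof -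
  note X = closedin_induced_topology_stable[OF nonaffine E]
  note Y = closedin_induced_topology_stable[OF nonaffine D]
  have "E_closed X E {t \<in> X. j t \<in> C}" if C: "E_closed Y D C" for C
    unfolding E_closed_def
  proof (intro conjI ballI)
    fix t assume "t \<in> X - {t \<in> X. j t \<in> C}"
    then have t: "t \<in> X" "j t \<in> Y - C" using j by auto
    then obtain \<zeta> where "\<zeta> \<in> D" "\<forall>s\<in>C. \<zeta> s = 0" "\<zeta> (j t) \<noteq> 0"
      using C unfolding E_closed_def by blast
    then show "\<exists>\<xi>\<in>E. (\<forall>s\<in>{t \<in> X. j t \<in> C}. \<xi> s = 0) \<and> \<xi> t \<noteq> 0"
      using t unfolding restr by (intro bexI[of _ "\<lambda>t\<in>X. \<zeta> (j t)"]) auto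
  qed auto
  then have cont: "continuous_map (induced_topology X E) (induced_topology Y D) j"
    unfolding continuous_map_closedin X Y using j by auto
  have closed: "closed_map (induced_topology X E) (subtopology (induced_topology Y D) (j ` X)) j"
    unfolding closed_map_def closedin_subtopology X Y
  proof (intro allI impI exI conjI)
    fix S assume S: "E_closed X E S"
    \<comment> \<open>The closure of \<open>j\<close>
      S\<open>in\<close>Y\<open>: the common zeros of all members of\<close>D\<open>that vanish on\<close>j
      \<open>S\<close>.\<close>
    define C where "C = {y \<in> Y. \<forall>\<zeta>\<in>D. (\<forall>s\<in>S. \<zeta> (j s) = 0) \<longrightarrow> \<zeta> y = 0}"
    have SX: "S \<subseteq> X" using S by (simp add: E_closed_def)
    show "E_closed Y D C"
      unfolding E_closed_def
    proof (intro conjI ballI)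
      fix y assume "y \<in> Y - C"
      then obtain \<zeta> where "\<zeta> \<in> D" "\<forall>s\<in>S. \<zeta> (j s) = 0" "\<zeta> y \<noteq> 0"
        unfolding C_def by blast
      then show "\<exists>\<zeta>\<in>D. (\<forall>s\<in>C. \<zeta> s = 0) \<and> \<zeta> y \<noteq> 0"
        unfolding C_def by blast
    qed (auto simp: C_def)
    have "t \<in> S" if "t \<in> X" "j t \<in> C" for t
    proof (rule ccontr)
      assume "t \<notin> S"
      then obtain \<xi> where \<xi>: "\<xi> \<in> E" "\<forall>s\<in>S. \<xi> s = 0" "\<xi> t \<noteq> 0"
        using S \<open>t \<in> X\<close> unfolding E_closed_def by blast
      then obtain \<zeta> where \<zeta>: "\<zeta> \<in> D" "\<xi> = (\<lambda>t\<in>X. \<zeta> (j t))"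
        by (auto simp: restr)
      have "\<zeta> (j s) = 0" if "s \<in> S" for s
        using \<xi>(2) SX that unfolding \<zeta>(2) by (metis restrict_apply' subsetD)
      then have "\<zeta> (j t) = 0"
        using \<open>j t \<in> C\<close> \<zeta>(1) unfolding C_def by blast
      then show False using \<xi>(3) \<open>t \<in> X\<close> unfolding \<zeta>(2) by simp
    qed
    moreover have "j s \<in> C" if "s \<in> S" for s
      using that SX j(2) unfolding C_def by blast
    ultimately show "j ` S = C \<inter> j ` X"
      using SX by blast
  qed
  show ?thesis
    unfolding embedding_map_def X
  proof (rule bijective_closed_imp_homeomorphic_map[OF _ closed])
    show "continuous_map (induced_topology X E) (subtopology (induced_topology Y D) (j ` X)) j"
      using cont by (simp add: continuous_map_in_subtopology X)
    show "j ` topspace (induced_topology X E)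
        = topspace (subtopology (induced_topology Y D) (j ` X))"
      using j(2) by (simp add: X Y Int_absorb1)
    show "inj_on j (topspace (induced_topology X E))"
      using j(1) by (simp add: X)
  qed
qed

section \<open>The space of extensions to the disjoint sum\<close>

definition sum_extension ::
    "'x set \<Rightarrow> 'y set \<Rightarrow> (('x \<Rightarrow> 'k) \<Rightarrow> ('y \<Rightarrow> 'k)) \<Rightarrow> ('x \<Rightarrow> 'k) \<Rightarrow> 'x + 'y \<Rightarrow> 'k"
  where "sum_extension X Y \<phi> \<xi> = (\<lambda>z\<in>X <+> Y. case_sum \<xi> (\<phi> \<xi>) z)"

lemma sum_extension_simps [simp]:
  "t \<in> X \<Longrightarrow> sum_extension X Y \<phi> \<xi> (Inl t) = \<xi> t"
  "s \<in> Y \<Longrightarrow> sum_extension X Y \<phi> \<xi> (Inr s) = \<phi> \<xi> s"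
  by (simp_all add: sum_extension_def InlI InrI)

lemma sum_extension_extensional [simp]: "sum_extension X Y \<phi> \<xi> \<in> extensional (X <+> Y)"
  by (simp add: sum_extension_def)

lemma sum_extension_eqI:
  assumes "\<zeta> \<in> extensional (X <+> Y)"
    and "\<And>t. t \<in> X \<Longrightarrow> \<zeta> (Inl t) = \<xi> t" "\<And>s. s \<in> Y \<Longrightarrow> \<zeta> (Inr s) = \<phi> \<xi> s"
  shows "\<zeta> = sum_extension X Y \<phi> \<xi>"
  by (rule extensionalityI[OF assms(1)]) (use assms in \<open>auto simp: sum_extension_def\<close>)

text \<open>Each construction commutes with \<open>sum_extension\<close>: on the summand
  \<open>X\<close> trivially, on \<open>Y\<close> because \<open>\<phi>\<close> preserves
  it.\<close>

lemma sum_extension_space: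
  assumes F: "F \<subseteq> operations"
    and E: "linear_subspace X E" "contains_constants X E" "stable_under F X E"
    and hom: "unital_hom F X E Y E' \<phi>"
  shows "linear_subspace (X <+> Y) (sum_extension X Y \<phi> ` E)"
    and "contains_constants (X <+> Y) (sum_extension X Y \<phi> ` E)"
    and "stable_under F (X <+> Y) (sum_extension X Y \<phi> ` E)"
proof -
  let ?e = "sum_extension X Y \<phi>"
  have hom_add: "\<phi> (fun_add X \<xi> \<eta>) = fun_add Y (\<phi> \<xi>) (\<phi> \<eta>)" if "\<xi> \<in> E" "\<eta> \<in> E" for \<xi> \<eta>
    using hom that by (simp add: unital_hom_def linear_on_def)
  have hom_scale: "\<phi> (fun_scale X c \<xi>) = fun_scale Y c (\<phi> \<xi>)" if "\<xi> \<in> E" for c \<xi>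
    using hom that by (simp add: unital_hom_def linear_on_def)
  \<comment> \<open>Unitality speaks of the constant 1 only; linearity carries it to every
    \<open>c\<close>.\<close>
  have hom_const: "\<phi> (fun_const X c) = fun_const Y c" for c
  proof -
    have "fun_const X 1 \<in> E" using E(2) by (simp add: contains_constants_def)
    moreover have "fun_const X c = fun_scale X c (fun_const X 1)"
      by (auto simp: fun_const_def fun_scale_def)
    ultimately have "\<phi> (fun_const X c) = fun_scale Y c (\<phi> (fun_const X 1))"
      using hom_scale by metis
    also have "\<dots> = fun_const Y c"
      using hom by (auto simp: unital_hom_def fun_const_def fun_scale_def)
    finally show ?thesis .
  qed
  have "fun_add (X <+> Y) (?e \<xi>) (?e \<eta>) = ?e (fun_add X \<xi> \<eta>)" if "\<xi> \<in> E" "\<eta> \<in> E" for \<xi> \<eta>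
    using that by (intro sum_extension_eqI) (simp_all add: hom_add, simp_all add: fun_add_def InlI InrI)
  moreover have "fun_scale (X <+> Y) c (?e \<xi>) = ?e (fun_scale X c \<xi>)" if "\<xi> \<in> E" for c \<xi>
    using that by (intro sum_extension_eqI) (simp_all add: hom_scale, simp_all add: fun_scale_def InlI InrI)
  moreover have const_eq: "fun_const (X <+> Y) c = ?e (fun_const X c)" for c
    by (intro sum_extension_eqI) (simp_all add: hom_const, simp_all add: fun_const_def InlI InrI)
  moreover have "?e ` E \<subseteq> extensional (X <+> Y)"
    by auto
  ultimately show "linear_subspace (X <+> Y) (?e ` E)"
    using E(2) linear_subspace_add[OF E(1)] linear_subspace_scale[OF E(1)]
    unfolding linear_subspace_def contains_constants_def by auto
  show "contains_constants (X <+> Y) (?e ` E)"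
    using E(2) unfolding contains_constants_def const_eq by blast
  show "stable_under F (X <+> Y) (?e ` E)"
    unfolding stable_under_def operates_on_def
  proof (intro ballI case_prodI2 allI impI)
    fix p n f and \<zeta>s assume p: "p \<in> F" "p = (n, f)"
      and \<zeta>s: "length \<zeta>s = n \<and> set \<zeta>s \<subseteq> ?e ` E"
    \<comment> \<open>All entries of \<open>\<zeta>s\<close> are lifted to \<open>E\<close> at
      once.\<close>
    have "\<zeta>s \<in> map ?e ` lists E"
      using \<zeta>s unfolding lists_image[symmetric] by blast
    then obtain \<xi>s where "\<zeta>s = map ?e \<xi>s" "\<xi>s \<in> lists E" ..
    with \<zeta>s have \<xi>s: "length \<xi>s = n" "set \<xi>s \<subseteq> E" "\<zeta>s = map ?e \<xi>s"
      by auto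
    have "\<phi> (fun_apply X f \<xi>s) = fun_apply Y f (map \<phi> \<xi>s)"
      using hom p \<xi>s unfolding unital_hom_def by blast
    then have "fun_apply (X <+> Y) f \<zeta>s = ?e (fun_apply X f \<xi>s)"
      by (intro sum_extension_eqI) (simp_all add: \<xi>s(3) fun_apply_def o_def InlI InrI)
    moreover have "fun_apply X f \<xi>s \<in> E"
      using E(3) p \<xi>s unfolding stable_under_def operates_on_def by blast
    ultimately show "fun_apply (X <+> Y) f \<zeta>s \<in> ?e ` E" by blast
  qed
qed

section \<open>Density of \<open>I\<close>, and existence and uniqueness of continuous
  extensions\<close>

theorem corollary6:
  fixes F :: "(nat \<times> ('k::field list \<Rightarrow> 'k)) set"
    and I :: "'i set" and I' :: "'j set"
    and E :: "('i \<Rightarrow> 'k) set" and E' :: "('j \<Rightarrow> 'k) set"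
    and \<phi> :: "('i \<Rightarrow> 'k) \<Rightarrow> ('j \<Rightarrow> 'k)"
  assumes "F \<subseteq> operations"
    and "\<exists>(n, f)\<in>F. \<not> additively_affine n f"
    and "Hausdorff_space (field_topology F)"
    and "linear_subspace I E" and "contains_constants I E" and "stable_under F I E"
    and "linear_subspace I' E'" and "contains_constants I' E'" and "stable_under F I' E'"
    and "unital_hom F I E I' E' \<phi>"
  shows "\<exists>T :: ('i + 'j) topology.
    topspace T = I <+> I' \<and>
    embedding_map (induced_topology I E) T Inl \<and>
    T closure_of (Inl ` I) = topspace T \<and>
    (\<forall>\<xi>\<in>E. \<exists>\<zeta>. continuous_extension T (field_topology F) I \<xi> \<zeta> \<and>
       (\<forall>\<zeta>'. continuous_extension T (field_topology F) I \<xi> \<zeta>' \<longrightarrow> \<zeta>' = \<zeta>) \<and>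
       \<phi> \<xi> = (\<lambda>t\<in>I'. \<zeta> (Inr t)))"
proof -
  note F = assms(1,2) and E = assms(4-6) and hom = assms(10)
  let ?e = "sum_extension I I' \<phi>"
  let ?D = "?e ` E"
  let ?T = "induced_topology (I <+> I') ?D"
  note D = sum_extension_space[OF F(1) E hom]
  note T = closedin_induced_topology_stable[OF F(2) D]
  have restr: "(\<lambda>t\<in>I. ?e \<xi> (Inl t)) = \<xi>" if "\<xi> \<in> E" for \<xi>
  proof -
    have "\<xi> \<in> extensional I" using E(1) that by (auto simp: linear_subspace_def)
    then show ?thesis by (auto intro!: extensionalityI[of _ I])
  qed
  have restr': "(\<lambda>t\<in>I'. ?e \<xi> (Inr t)) = \<phi> \<xi>" if "\<xi> \<in> E" for \<xi>
  proof -
    have "\<phi> \<xi> \<in> extensional I'"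
      using assms(7) hom that by (auto simp: linear_subspace_def unital_hom_def)
    then show ?thesis by (auto intro!: extensionalityI[of _ I'])
  qed
  \<comment> \<open>By \<open>restr\<close>, restricting \<open>?D\<close> along \<open>Inl\<close>
    gives back exactly \<open>E\<close>.\<close>
  have emb: "embedding_map (induced_topology I E) ?T Inl"
    by (rule embedding_map_induced_topology[OF F(2) E D]) (auto simp: image_image restr)
  \<comment> \<open>A point outside \<open>C\<close> would be separated from \<open>C\<close> by
    some \<open>?e \<xi>\<close> that vanishes on \<open>I\<close>. Then \<open>\<xi>\<close> is
    zero, and so is \<open>?e \<xi>\<close>.\<close>
  have "C = I <+> I'" if C: "E_closed (I <+> I') ?D C" "Inl ` I \<subseteq> C" for C
  proof (rule ccontr)
    assume "C \<noteq> I <+> I'"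
    then obtain z where z: "z \<in> I <+> I' - C" using C(1) by (auto simp: E_closed_def)
    then obtain \<xi> where \<xi>: "\<xi> \<in> E" "\<forall>s\<in>C. ?e \<xi> s = 0" "?e \<xi> z \<noteq> 0"
      using C(1) unfolding E_closed_def by blast
    \<comment> \<open>The zero function is some \<open>?e \<eta>\<close>. Comparing values on
      \<open>I\<close> gives \<open>\<xi> = \<eta>\<close>, so \<open>?e \<xi>\<close> is zero on
      \<open>I'\<close> as well.\<close>
    have "fun_const (I <+> I') 0 \<in> ?D" using D(1) by (simp add: linear_subspace_def)
    then obtain \<eta> where \<eta>: "\<eta> \<in> E" "fun_const (I <+> I') 0 = ?e \<eta>" by blast
    have "?e \<xi> (Inl t) = ?e \<eta> (Inl t)" if "t \<in> I" for t
      unfolding \<eta>(2)[symmetric] using \<xi>(2) C(2) that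
      by (simp add: fun_const_def InlI image_subset_iff del: sum_extension_simps)
    then have "\<xi> = \<eta>" using restr[OF \<xi>(1)] restr[OF \<eta>(1)] by (metis (no_types, lifting) restrict_ext)
    then show False using \<xi>(3) z \<eta>(2)[symmetric] by (simp add: fun_const_def)
  qed
  then have dense: "?T closure_of (Inl ` I) = topspace ?T"
    using closedin_closure_of[of ?T "Inl ` I"] closure_of_subset[of "Inl ` I" ?T]
    unfolding T by auto
  have cont: "continuous_extension ?T (field_topology F) I \<xi> (?e \<xi>)" if "\<xi> \<in> E" for \<xi>
    unfolding continuous_extension_def T
    using continuous_map_induced_topology[OF F D imageI[OF that]]
    by simp
  have uniq: "\<zeta> = ?e \<xi>" if \<xi>: "\<xi> \<in> E" "continuous_extension ?T (field_topology F) I \<xi> \<zeta>" for \<xi> \<zeta>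
  proof (rule extensionalityI)
    show "\<zeta> \<in> extensional (topspace ?T)" "?e \<xi> \<in> extensional (topspace ?T)"
      using \<xi>(2) cont[OF \<xi>(1)] by (simp_all add: continuous_extension_def)
    \<comment> \<open>Continuous maps into a Hausdorff space that agree on \<open>I\<close> agree on
      its closure, which is the whole space.\<close>
    show "\<zeta> z = ?e \<xi> z" if "z \<in> topspace ?T" for z
      by (rule forall_in_closure_of_eq[of z ?T "Inl ` I", OF _ assms(3)])
         (use \<xi> that dense cont[OF \<xi>(1)] in \<open>auto simp: continuous_extension_def\<close>)
  qed
  show ?thesis
  proof (intro exI[of _ ?T] conjI ballI)
    fix \<xi> assume \<xi>: "\<xi> \<in> E"
    show "\<exists>\<zeta>. continuous_extension ?T (field_topology F) I \<xi> \<zeta> \<and>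
        (\<forall>\<zeta>'. continuous_extension ?T (field_topology F) I \<xi> \<zeta>' \<longrightarrow> \<zeta>' = \<zeta>) \<and>
        \<phi> \<xi> = (\<lambda>t\<in>I'. \<zeta> (Inr t))"
      using cont[OF \<xi>] uniq[OF \<xi>] restr'[OF \<xi>, symmetric] by blast
  qed (fact T(1) emb dense)+
qed

end
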